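(* For any positive integer $k$, any non-negative integer $m$, and any partition $\lambda\in\mathcal{P}_k^+$, we have $p_{\lambda\bmod k}(m)=p(m)$.
   Context: A partition is a finite weakly decreasing sequence $\lambda=(\lambda_1,\dots,\lambda_\ell)$ of positive integers; the empty partition $\emptyset$ is allowed; $\ell(\lambda)=\ell$ is its length and $|\lambda|=\sum_i\lambda_i$ its size; by convention $\lambda_j=0$ for $j>\ell(\lambda)$. $\mathcal{P}$ is the set of all partitions and $p(m)$ is the number of partitions of size $m$. $\mathcal{P}_k^+$ is the set of partitions in which the difference between any two consecutive parts is less than $k$ and the smallest part is less than $k$ (it contains $\emptyset$). Component-wise reduction modulo $k$ sends a partition $\lambda=(\lambda_1,\dots,\lambda_\ell)$ to $\lambda'=(\lambda_1',\dots,\lambda_\ell')$ (trailing zeros omitted; $\emptyset\mapsto\emptyset$), where $\lambda_\ell'=\lambda_\ell-\lfloor\lambda_\ell/k\rfloor k$ and, recursively for $j=\ell-1,\dots,1$, $\lambda_j'=\lambda_j-\left\lfloor(\lambda_j-\lambda_{j+1}')/k\right\rfloor k$. For $\lambda\in\mathcal{P}_k^+$ and $m\ge 0$, $p_{\lambda\bmod k}(m)$ denotes the number of partitions in $\mathcal{P}$ of size $|\lambda|+mk$ whose component-wise reduction modulo $k$ is $\lambda$; equivalently, the number of partitions $\gamma\in\mathcal{P}$ with $|\gamma|=|\lambda|+mk$ and $\gamma_j\equiv\lambda_j\pmod k$ for all $j\ge 1$. *)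

theory Defs
  imports Main "HOL-Library.More_List"
begin

definition partitions :: "nat list set" where
  "partitions = {xs. sorted_wrt (\<ge>) xs \<and> (\<forall>x\<in>set xs. 0 < x)}"

definition num_partitions :: "nat \<Rightarrow> nat" where
  "num_partitions n = card {xs \<in> partitions. sum_list xs = n}"

(* The subtraction on nat is exact here, since the parts are weakly decreasing. *)
definition partitions_plus :: "nat \<Rightarrow> nat list set" where
  "partitions_plus k =
     {xs \<in> partitions.
        (\<forall>j. Suc j < length xs \<longrightarrow> xs ! j - xs ! Suc j < k) \<and>
        (xs \<noteq> [] \<longrightarrow> last xs < k)}"

(* Division on nat is the floor of the quotient. On weakly decreasing lists both
   subtractions are exact: the reduced next part hd zs is at most y, hence at most x. *)
fun reduce_parts :: "nat \<Rightarrow> nat list \<Rightarrow> nat list" where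
  "reduce_parts k [] = []"
| "reduce_parts k [x] = [x - x div k * k]"
| "reduce_parts k (x # y # ys) =
     (let zs = reduce_parts k (y # ys) in (x - (x - hd zs) div k * k) # zs)"

definition reduction :: "nat \<Rightarrow> nat list \<Rightarrow> nat list" where
  "reduction k xs = strip_while (\<lambda>x. x = 0) (reduce_parts k xs)"

definition num_partitions_mod :: "nat \<Rightarrow> nat list \<Rightarrow> nat \<Rightarrow> nat" where
  "num_partitions_mod k xs m =
     card {ys \<in> partitions. sum_list ys = sum_list xs + m * k \<and> reduction k ys = xs}"

(* The sets counted above are finite, so card is the genuine number of elements. *)
lemma finite_partitions_of_size: "finite {xs \<in> partitions. sum_list xs = n}"
proof (rule finite_subset)
  have "length xs \<le> sum_list xs" if "\<forall>x\<in>set xs. 0 < x" for xs :: "nat list"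
    using that by (induction xs) auto
  then show "{xs \<in> partitions. sum_list xs = n} \<subseteq> {xs. set xs \<subseteq> {..n} \<and> length xs \<le> n}"
    by (auto simp: partitions_def dest: member_le_sum_list)
  show "finite {xs. set xs \<subseteq> {..n} \<and> length xs \<le> n}"
    by (rule finite_lists_length_le) simp
qed

lemma finite_partitions_mod:
  "finite {ys \<in> partitions. sum_list ys = sum_list xs + m * k \<and> reduction k ys = xs}"
  by (rule finite_subset[OF _ finite_partitions_of_size[of "sum_list xs + m * k"]]) auto

end

theory Submission
  imports Defs "HOL-Computational_Algebra.Polynomial"
begin

text \<open>
  A partition is identified with the polynomial over the natural numbers whose coefficients are its
  parts, so that padding with zeros is built in. Since consecutive parts of \<open>\<lambda> \<in> P\<^sub>k\<^sup>+\<close> differ by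
  less than \<open>k\<close>, the weakly decreasing \<open>\<gamma>\<close> that reduce to \<open>\<lambda>\<close> are exactly the
  \<open>\<lambda> + k \<mu>\<close> with \<open>\<mu>\<close> weakly decreasing, and then \<open>|\<gamma>| = |\<lambda>| + k |\<mu>|\<close>.
\<close>

lemma no_trailing_partition:
  assumes "xs \<in> partitions"
  shows "no_trailing (HOL.eq 0) xs"
  using assms by (force simp: partitions_def no_trailing_unfold dest: last_in_set)

lemma antimono_nth_default_partition:
  assumes "xs \<in> partitions"
  shows "antimono (nth_default 0 xs)"
proof (rule antimonoI)
  fix i j :: nat
  assume "i \<le> j"
  then show "nth_default 0 xs j \<le> nth_default 0 xs i"
    using assms by (cases "i = j") (auto simp: nth_default_def partitions_def sorted_wrt_iff_nth_less)
qed

text \<open>By monotonicity every coefficient up to the degree is at least the leading one, which is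
  nonzero; hence all listed parts are positive.\<close>

lemma coeffs_mem_partitions:
  fixes p :: "nat poly"
  assumes "antimono (coeff p)"
  shows "coeffs p \<in> partitions"
proof -
  have "0 < coeff p i" if "i < length (coeffs p)" for i
  proof -
    from that have "p \<noteq> 0"
      by auto
    with that have "i \<le> degree p"
      by (simp add: length_coeffs_degree)
    then have "lead_coeff p \<le> coeff p i"
      using assms by (simp add: antimonoD)
    moreover have "lead_coeff p \<noteq> 0"
      using \<open>p \<noteq> 0\<close> by simp
    ultimately show ?thesis by linarith
  qed
  moreover have "coeffs p ! i = coeff p i" if "i < length (coeffs p)" for i
    using that by (metis nth_default_coeffs_eq nth_default_nth)
  ultimately show ?thesis
    using assms
    by (auto simp: partitions_def sorted_wrt_iff_nth_less in_set_conv_nth intro: antimonoD)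
qed

lemma bij_betw_coeffs_partitions:
  "bij_betw coeffs {p :: nat poly. antimono (coeff p)} partitions"
proof (rule bij_betw_byWitness[where f' = Poly])
  show "\<forall>xs\<in>partitions. coeffs (Poly xs) = xs"
    using no_trailing_partition by simp
  show "Poly ` partitions \<subseteq> {p. antimono (coeff p)}"
    using antimono_nth_default_partition by (auto simp: coeff_Poly_eq[abs_def])
qed (use coeffs_mem_partitions in auto)

lemma sum_list_coeffs: "sum_list (coeffs p) = poly p (1 :: nat)"
proof -
  have "poly (Poly xs) 1 = sum_list xs" for xs :: "nat list"
    by (induction xs) auto
  then show ?thesis by (metis Poly_coeffs)
qed

text \<open>Serves to move both counts in the theorem from lists to polynomials.\<close>

lemma card_partitions_filter:
  "card {xs \<in> partitions. Q xs} = card {p :: nat poly. antimono (coeff p) \<and> Q (coeffs p)}"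
proof -
  have "{xs \<in> partitions. Q xs} = coeffs ` {p. antimono (coeff p) \<and> Q (coeffs p)}"
    using bij_betw_coeffs_partitions by (auto simp: bij_betw_def)
  moreover have "inj_on coeffs {p :: nat poly. antimono (coeff p) \<and> Q (coeffs p)}"
    using coeffs_eq_iff by (auto simp: inj_on_def)
  ultimately show ?thesis by (simp add: card_image)
qed

text \<open>After padding with zeros, the bound on the smallest part is the difference bound at the
  last index. Beyond it both entries are 0, and \<open>0 < k\<close> suffices.\<close>

lemma partitions_plus_diff_less:
  assumes "0 < k" and "xs \<in> partitions_plus k"
  shows "nth_default 0 xs j - nth_default 0 xs (Suc j) < k"
proof (cases "Suc j = length xs")
  case True
  then show ?thesis
    using assms by (auto simp: partitions_plus_def nth_default_def last_conv_nth dest: sym)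
next
  case False
  then show ?thesis
    using assms by (auto simp: partitions_plus_def nth_default_def)
qed

text \<open>The default value 0 turns the rule for the last part into an instance of the general
  rule, so one recurrence covers all indices.\<close>

lemma nth_default_reduce_parts:
  "nth_default 0 (reduce_parts k xs) j =
     nth_default 0 xs j - (nth_default 0 xs j - nth_default 0 (reduce_parts k xs) (Suc j)) div k * k"
proof (induction k xs arbitrary: j rule: reduce_parts.induct)
  case (2 k x)
  then show ?case by (cases j) auto
next
  case (3 k x y ys)
  have "reduce_parts k (y # ys) \<noteq> []"
    by (cases ys) (auto simp: Let_def)
  then have "hd (reduce_parts k (y # ys)) = nth_default 0 (reduce_parts k (y # ys)) 0"
    by (simp add: nth_default_def hd_conv_nth)
  then show ?case
    using "3.IH"[of "j - 1"] by (cases j) (simp_all add: Let_def)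
qed simp

text \<open>The recurrence runs from high indices to low ones. Above both degrees all coefficients
  vanish, which fixes the starting value.\<close>

lemma poly_eqI_backward_recurrence:
  fixes p q :: "'a::zero poly"
  assumes "\<And>j. coeff p j = F j (coeff p (Suc j))"
    and "\<And>j. coeff q j = F j (coeff q (Suc j))"
  shows "p = q"
proof (rule poly_eqI)
  define N where "N = Suc (max (degree p) (degree q))"
  have "coeff p j = coeff q j" if "N \<le> j + n" for j n
    using that
  proof (induction n arbitrary: j)
    case 0
    then show ?case by (simp add: N_def coeff_eq_0)
  next
    case (Suc n)
    then have "coeff p (Suc j) = coeff q (Suc j)" by simp
    then show ?case using assms(1)[of j] assms(2)[of j] by simp
  qed
  then show "coeff p j = coeff q j" for j by (meson le_add2)
qed

text \<open>By uniqueness for the backward recurrence, the recursively computed next part can be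
  replaced by the known entry of \<open>xs\<close>. The resulting condition is checked index by
  index, without recursion.\<close>

lemma reduction_coeffs_eq_iff:
  assumes "no_trailing (HOL.eq 0) xs"
  shows "reduction k (coeffs p) = xs \<longleftrightarrow>
    (\<forall>j. nth_default 0 xs j = coeff p j - (coeff p j - nth_default 0 xs (Suc j)) div k * k)"
proof -
  have "reduction k (coeffs p) = coeffs (Poly (reduce_parts k (coeffs p)))"
    by (simp add: reduction_def eq_commute[of 0, abs_def])
  moreover have "xs = coeffs (Poly xs)"
    using assms by simp
  ultimately have "reduction k (coeffs p) = xs \<longleftrightarrow> Poly (reduce_parts k (coeffs p)) = Poly xs"
    by (metis coeffs_eq_iff)
  also have "\<dots> \<longleftrightarrow>
    (\<forall>j. nth_default 0 xs j = coeff p j - (coeff p j - nth_default 0 xs (Suc j)) div k * k)"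
    (is "?eq \<longleftrightarrow> ?rec")
  proof
    have red: "nth_default 0 (reduce_parts k (coeffs p)) j =
      coeff p j - (coeff p j - nth_default 0 (reduce_parts k (coeffs p)) (Suc j)) div k * k" for j
      using nth_default_reduce_parts[of k "coeffs p" j] by (simp add: nth_default_coeffs_eq)
    show ?rec if ?eq
    proof -
      have "nth_default 0 (reduce_parts k (coeffs p)) = nth_default 0 xs"
        using that by (simp add: fun_eq_iff poly_eq_iff)
      from red[unfolded this] show ?thesis by (rule allI)
    qed
    show ?eq if ?rec
      by (rule poly_eqI_backward_recurrence
          [where F = "\<lambda>j c. coeff p j - (coeff p j - c) div k * k"], unfold coeff_Poly_eq)
        (rule red that[rule_format])+
  qed
  finally show ?thesis .
qed

text \<open>The quotients in the recurrence are the coefficients of \<open>q\<close>; this makes the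
  reducing polynomials a scaled and translated copy of those counted by \<open>p(m)\<close>.\<close>

lemma reducing_polys_eq_image:
  fixes L :: "nat poly"
  assumes "0 < k" and anti: "antimono (coeff L)"
    and diff: "\<And>j. coeff L j - coeff L (Suc j) < k"
  shows "{p. antimono (coeff p) \<and> poly p 1 = poly L 1 + m * k \<and>
            (\<forall>j. coeff L j = coeff p j - (coeff p j - coeff L (Suc j)) div k * k)}
       = (\<lambda>q. L + smult k q) ` {q. antimono (coeff q) \<and> poly q 1 = m}"
    (is "?A = _ ` ?B")
proof (intro equalityI subsetI)
  fix p assume "p \<in> (\<lambda>q. L + smult k q) ` ?B"
  then obtain q where p: "p = L + smult k q" and q: "antimono (coeff q)" "poly q 1 = m"
    by auto
  have "antimono (coeff p)"
    using anti q(1) unfolding antimono_def p by (auto intro!: add_mono)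
  moreover have "coeff L j = coeff p j - (coeff p j - coeff L (Suc j)) div k * k" for j
  proof -
    have "coeff L (Suc j) \<le> coeff L j"
      using anti by (simp add: antimonoD)
    \<comment> \<open>This is a division with remainder by \<open>k\<close>: \<open>diff\<close>
      bounds the difference of the \<open>L\<close> coefficients by \<open>k\<close>, so the
      quotient is \<open>coeff q j\<close>.\<close>
    then have "coeff p j - coeff L (Suc j) = coeff L j - coeff L (Suc j) + coeff q j * k"
      by (simp add: p mult.commute)
    then have "(coeff p j - coeff L (Suc j)) div k = coeff q j"
      using diff[of j] \<open>0 < k\<close> by simp
    then show ?thesis by (simp add: p)
  qed
  moreover have "poly p 1 = poly L 1 + m * k"
    using q(2) by (simp add: p mult.commute)
  ultimately show "p \<in> ?A" by blast
next
  fix p assume "p \<in> ?A"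
  then have p: "antimono (coeff p)" "poly p 1 = poly L 1 + m * k"
    and red: "\<And>j. coeff L j = coeff p j - (coeff p j - coeff L (Suc j)) div k * k"
    by blast+
  \<comment> \<open>Beyond \<open>degree p\<close> the truncated subtraction from 0 gives 0, so this
    is a polynomial.\<close>
  define q where "q = Abs_poly (\<lambda>j. (coeff p j - coeff L (Suc j)) div k)"
  have coeff_q: "coeff q j = (coeff p j - coeff L (Suc j)) div k" for j
    unfolding q_def by (subst coeff_Abs_poly[of "degree p"]) (auto simp: coeff_eq_0)
  have split: "coeff p j = coeff L j + k * coeff q j" for j
  proof -
    \<comment> \<open>Excludes truncation in \<open>red\<close>, which can then be solved for
      \<open>coeff p j\<close>.\<close>
    have "(coeff p j - coeff L (Suc j)) div k * k \<le> coeff p j"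
      by (meson diff_le_self div_times_less_eq_dividend le_trans)
    then show ?thesis
      using red[of j] by (simp add: coeff_q mult.commute)
  qed
  then have p_eq: "p = L + smult k q"
    by (simp add: poly_eq_iff)
  have "coeff q (Suc j) \<le> coeff q j" for j
  proof -
    \<comment> \<open>The left side is \<open>coeff p (Suc j)\<close>. Subtracting
      \<open>coeff L (Suc j)\<close> and taking the floor of the quotient by \<open>k\<close> turns
      the right side into \<open>coeff q j\<close>.\<close>
    have "coeff L (Suc j) + k * coeff q (Suc j) \<le> coeff p j"
      using p(1) split[of "Suc j"] by (metis antimonoD le_SucI order_refl)
    then have "coeff q (Suc j) * k \<le> coeff p j - coeff L (Suc j)"
      by (simp add: mult.commute)
    then show ?thesis
      using \<open>0 < k\<close> by (simp add: coeff_q[of j] less_eq_div_iff_mult_less_eq)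
  qed
  then have "antimono (coeff q)"
    by (simp add: antimono_iff_le_Suc)
  moreover have "poly q 1 = m"
    using p(2) \<open>0 < k\<close> by (simp add: p_eq mult.commute)
  ultimately show "p \<in> (\<lambda>q. L + smult k q) ` ?B"
    using p_eq by blast
qed

theorem theorem13:
  fixes k m :: nat and lam :: "nat list"
  assumes "k > 0"
    and "lam \<in> partitions_plus k"
  shows "num_partitions_mod k lam m = num_partitions m"
proof -
  have lam: "lam \<in> partitions"
    using assms(2) by (simp add: partitions_plus_def)
  note nt = no_trailing_partition[OF lam]
  have sum_lam: "sum_list lam = poly (Poly lam) 1"
    using sum_list_coeffs[of "Poly lam"] nt by simp
  have coeff_lam: "nth_default 0 lam = coeff (Poly lam)"
    by (simp add: coeff_Poly_eq fun_eq_iff)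
  have "num_partitions_mod k lam m =
    card {p. antimono (coeff p) \<and> poly p 1 = poly (Poly lam) 1 + m * k \<and>
      (\<forall>j. coeff (Poly lam) j = coeff p j - (coeff p j - coeff (Poly lam) (Suc j)) div k * k)}"
    unfolding num_partitions_mod_def card_partitions_filter sum_list_coeffs
      reduction_coeffs_eq_iff[OF nt] sum_lam coeff_lam ..
  also have "\<dots> =
    card ((\<lambda>q. Poly lam + smult k q) ` {q. antimono (coeff q) \<and> poly q 1 = m})"
    using assms antimono_nth_default_partition[OF lam] partitions_plus_diff_less
    by (subst reducing_polys_eq_image) (auto simp: coeff_lam[symmetric] coeff_Poly_eq)
  \<comment> \<open>Scaling by \<open>k > 0\<close> followed by a translation is injective.\<close>
  also have "\<dots> = card {q :: nat poly. antimono (coeff q) \<and> poly q 1 = m}"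
    using assms(1) by (intro card_image) (auto simp: inj_on_def poly_eq_iff)
  also have "\<dots> = num_partitions m"
    unfolding num_partitions_def card_partitions_filter sum_list_coeffs ..
  finally show ?thesis .
qed

end
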